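(* Let $\mathcal{A}$ be an $n\times n$ star sign pattern. Then $\mathcal{A}$ does not allow the nSMP if and only if $D(\mathcal{A})$ has fewer than $n-3$ non-centre loops, i.e. fewer than $n-3$ of the diagonal entries $\mathcal{A}_{22},\dots,\mathcal{A}_{nn}$ are nonzero.
   Context: A real $n\times n$ matrix $A$ has the non-symmetric strong multiplicity property (nSMP) if the only real $n\times n$ matrix $X$ satisfying all of (1) $A\circ X=O$ (entrywise product), (2) $AX^T-X^TA=O$, and (3) $\mathrm{tr}(X^TA^k)=0$ for all $0\le k<n$, is $X=O$ (the zero matrix). A sign pattern is an $n\times n$ matrix $\mathcal{A}$ with entries in $\{+,-,0\}$; $Q(\mathcal{A})$ is the set of real $n\times n$ matrices $A$ with $A_{ij}>0$ if $\mathcal{A}_{ij}=+$, $A_{ij}<0$ if $\mathcal{A}_{ij}=-$, and $A_{ij}=0$ if $\mathcal{A}_{ij}=0$. The pattern $\mathcal{A}$ allows a property if some $A\in Q(\mathcal{A})$ has the property. A star sign pattern is an $n\times n$ sign pattern $\mathcal{A}$ with $\mathcal{A}_{1j}\neq 0$ and $\mathcal{A}_{j1}\ne 0$ for all $2\le j\le n$, with $\mathcal{A}_{ij}=0$ for all $i\neq j$ with $i,j\ge 2$, and with arbitrary diagonal entries in $\{0,+,-\}$. The digraph $D(\mathcal{A})$ has vertices $v_1,\dots,v_n$ and an arc from $v_i$ to $v_j$ if and only if $\mathcal{A}_{ij}\ne 0$; $v_1$ is the centre, and a non-centre loop is a loop at some $v_i$ with $i\ge 2$. *)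

theory Defs
  imports "Jordan_Normal_Form.Matrix" "Graph_Theory.Pair_Digraph"
begin

text \<open>
  Matrices are those of \<open>Jordan_Normal_Form\<close>, indexed from 0: the entry written
  \<open>(i, j)\<close> with \<open>1 \<le> i, j \<le> n\<close> on paper is \<open>A $$ (i - 1, j - 1)\<close>, and vertex \<open>v\<^sub>i\<close> is \<open>i - 1\<close>.
  In particular the centre of a star is the index 0.
\<close>

definition hadamard_prod :: "'a::times mat \<Rightarrow> 'a mat \<Rightarrow> 'a mat" where
  "hadamard_prod A B = mat (dim_row A) (dim_col A) (\<lambda>(i, j). A $$ (i, j) * B $$ (i, j))"

definition mat_trace :: "'a::comm_monoid_add mat \<Rightarrow> 'a" where
  "mat_trace A = (\<Sum>i<dim_row A. A $$ (i, i))"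

definition has_nSMP :: "nat \<Rightarrow> real mat \<Rightarrow> bool" where
  "has_nSMP n A \<longleftrightarrow>
     (\<forall>X \<in> carrier_mat n n.
        hadamard_prod A X = 0\<^sub>m n n \<longrightarrow>
        A * X\<^sup>T - X\<^sup>T * A = 0\<^sub>m n n \<longrightarrow>
        (\<forall>k<n. mat_trace (X\<^sup>T * (A ^\<^sub>m k)) = 0) \<longrightarrow>
        X = 0\<^sub>m n n)"

datatype sign = Pos | Neg | Zero

definition qualitative_class :: "nat \<Rightarrow> sign mat \<Rightarrow> real mat set" where
  "qualitative_class n S =
     {A \<in> carrier_mat n n. \<forall>i<n. \<forall>j<n.
        (S $$ (i, j) = Pos \<longrightarrow> A $$ (i, j) > 0) \<and>
        (S $$ (i, j) = Neg \<longrightarrow> A $$ (i, j) < 0) \<and>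
        (S $$ (i, j) = Zero \<longrightarrow> A $$ (i, j) = 0)}"

definition allows :: "nat \<Rightarrow> sign mat \<Rightarrow> (real mat \<Rightarrow> bool) \<Rightarrow> bool" where
  "allows n S P \<longleftrightarrow> (\<exists>A \<in> qualitative_class n S. P A)"

definition star_sign_pattern :: "nat \<Rightarrow> sign mat \<Rightarrow> bool" where
  "star_sign_pattern n S \<longleftrightarrow>
     0 < n \<and> S \<in> carrier_mat n n \<and>
     (\<forall>j. 1 \<le> j \<and> j < n \<longrightarrow> S $$ (0, j) \<noteq> Zero \<and> S $$ (j, 0) \<noteq> Zero) \<and>
     (\<forall>i j. 1 \<le> i \<and> i < n \<and> 1 \<le> j \<and> j < n \<and> i \<noteq> j \<longrightarrow> S $$ (i, j) = Zero)"

definition pattern_digraph :: "nat \<Rightarrow> sign mat \<Rightarrow> nat pair_pre_digraph" where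
  "pattern_digraph n S =
     \<lparr> pverts = {..<n}, parcs = {(i, j). i < n \<and> j < n \<and> S $$ (i, j) \<noteq> Zero} \<rparr>"

definition noncentre_loops :: "nat pair_pre_digraph \<Rightarrow> (nat \<times> nat) set" where
  "noncentre_loops D = {(i, j) \<in> parcs D. i = j \<and> i \<noteq> 0}"

end

theory Submission
  imports Defs
begin

text \<open>
  Write a matrix with star pattern as having centre row \<open>u\<close>, centre column \<open>v\<close> and leaf diagonal
  \<open>d\<close>. If three entries of \<open>d\<close> vanish, then on these three leaves there are nonzero \<open>p\<close>
  orthogonal to \<open>u\<close> and \<open>q\<close> orthogonal to both \<open>v\<close> and \<open>p\<close>; the transpose of
  \<open>p q\<^sup>T\<close> violates the nSMP.
  Conversely, if at most two entries of \<open>d\<close> vanish and the nonzero ones are distinct, then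
  commutation forces \<open>X\<close> to be block diagonal with blocks of size one, except for one block of size
  two if two entries vanish. There the trace conditions give \<open>X = 0\<close> unless the partial scalar
  product of \<open>u\<close> and \<open>v\<close> over the two leaves is 0, which a suitable choice of the moduli
  of the entries of \<open>u\<close> excludes.
\<close>

section \<open>Star matrices with three loopless leaves\<close>

definition star_mat :: "nat \<Rightarrow> real mat \<Rightarrow> bool" where
  "star_mat n A \<longleftrightarrow> A \<in> carrier_mat n n \<and>
     (\<forall>j. 1 \<le> j \<and> j < n \<longrightarrow> A $$ (0, j) \<noteq> 0 \<and> A $$ (j, 0) \<noteq> 0) \<and>
     (\<forall>i j. 1 \<le> i \<and> i < n \<and> 1 \<le> j \<and> j < n \<and> i \<noteq> j \<longrightarrow> A $$ (i, j) = 0)"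

text \<open>The violating X is the transpose of p q^T. Both \<open>A * X\<^sup>T\<close> and
  \<open>X\<^sup>T * A\<close> vanish, not just their difference, so the trace conditions for
  positive k are automatic; the one for k = 0 is the orthogonality of p and q.\<close>

lemma not_has_nSMP_rank_one:
  fixes A :: "real mat" and p q :: "nat \<Rightarrow> real"
  assumes A: "A \<in> carrier_mat n n"
    and Ap: "\<And>i. i < n \<Longrightarrow> (\<Sum>k<n. A $$ (i, k) * p k) = 0"
    and qA: "\<And>j. j < n \<Longrightarrow> (\<Sum>k<n. q k * A $$ (k, j)) = 0"
    and pq: "(\<Sum>k<n. p k * q k) = 0"
    and had: "\<And>i j. i < n \<Longrightarrow> j < n \<Longrightarrow> A $$ (i, j) * (q i * p j) = 0"
    and nz: "i0 < n" "j0 < n" "q i0 \<noteq> 0" "p j0 \<noteq> 0"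
  shows "\<not> has_nSMP n A"
proof
  assume nSMP: "has_nSMP n A"
  define X where "X = mat n n (\<lambda>(i, j). q i * p j)"
  have X: "X \<in> carrier_mat n n" by (simp add: X_def)
  have "hadamard_prod A X = 0\<^sub>m n n"
    using A had by (intro eq_matI) (auto simp: hadamard_prod_def X_def)
  moreover have AX: "A * X\<^sup>T = 0\<^sub>m n n"
  proof (rule eq_matI; simp add: X_def A[THEN carrier_matD(1)])
    fix i j assume ij: "i < n" "j < n"
    have "(\<Sum>k<n. A $$ (i, k) * (q j * p k)) = q j * (\<Sum>k<n. A $$ (i, k) * p k)"
      by (simp add: sum_distrib_left mult_ac)
    then show "row A i \<bullet> vec n (\<lambda>k. q j * p k) = 0"
      using A Ap ij by (simp add: scalar_prod_def atLeast0LessThan)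
  qed
  have XA: "X\<^sup>T * A = 0\<^sub>m n n"
  proof (rule eq_matI; simp add: X_def A[THEN carrier_matD(2)])
    fix i j assume ij: "i < n" "j < n"
    have "(\<Sum>k<n. q k * p i * A $$ (k, j)) = p i * (\<Sum>k<n. q k * A $$ (k, j))"
      by (simp add: sum_distrib_left mult_ac)
    then show "vec n (\<lambda>k. q k * p i) \<bullet> col A j = 0"
      using A qA ij by (simp add: scalar_prod_def atLeast0LessThan)
  qed
  moreover have "A * X\<^sup>T - X\<^sup>T * A = 0\<^sub>m n n"
    by (simp add: AX XA)
  moreover have "mat_trace (X\<^sup>T * (A ^\<^sub>m k)) = 0" for k
  proof (cases k)
    case 0
    then show ?thesis
      using A X pq by (simp add: mat_trace_def X_def mult.commute)
  next
    case (Suc l)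
    have "X\<^sup>T * (A ^\<^sub>m Suc l) = 0\<^sub>m n n"
    proof (induction l)
      case 0
      then show ?case using A XA by simp
    next
      case (Suc l)
      have "X\<^sup>T * (A ^\<^sub>m Suc (Suc l)) = X\<^sup>T * (A ^\<^sub>m Suc l) * A"
        using assoc_mult_mat[OF transpose_carrier_mat[THEN iffD2, OF X] pow_carrier_mat[OF A] A,
            of "Suc l"]
        by simp
      then show ?case using A Suc by simp
    qed
    then show ?thesis using Suc by (simp add: mat_trace_def)
  qed
  ultimately have "X = 0\<^sub>m n n"
    using nSMP X unfolding has_nSMP_def by blast
  then have "X $$ (i0, j0) = 0" using nz by simp
  then show False using nz by (simp add: X_def)
qed

lemma star_mat_three_zeros_not_nSMP:
  assumes star: "star_mat n A"
    and leaves: "1 \<le> a" "a < n" "1 \<le> b" "b < n" "1 \<le> c" "c < n"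
    and dist: "a \<noteq> b" "a \<noteq> c" "b \<noteq> c"
    and zero: "A $$ (a, a) = 0" "A $$ (b, b) = 0" "A $$ (c, c) = 0"
  shows "\<not> has_nSMP n A"
proof -
  have A: "A \<in> carrier_mat n n" using star by (simp add: star_mat_def)
  have off: "A $$ (i, j) = 0" if "1 \<le> i" "i < n" "1 \<le> j" "j < n" "i \<noteq> j" for i j
    using star that unfolding star_mat_def by blast
  \<comment> \<open>Away from the centre the rows and columns of a, b, c are zero. Vectors p and q
    supported on these three leaves therefore only have to be orthogonal to the centre row and the
    centre column, respectively.\<close>
  have zcol: "A $$ (i, x) = 0" "A $$ (x, i) = 0" if "1 \<le> i" "i < n" "x \<in> {a, b, c}" for i x
    using off[of i x] off[of x i] that leaves zero by (cases "i = x"; auto)+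
  define u where "u j = A $$ (0, j)" for j
  define v where "v j = A $$ (j, 0)" for j
  have unz: "u a \<noteq> 0" "u b \<noteq> 0" "v c \<noteq> 0"
    using star leaves unfolding star_mat_def u_def v_def by auto
  \<comment> \<open>Two leaves suffice to make p orthogonal to the centre row. In the coordinates a,
    b, c, q is the cross product of v and p, hence orthogonal to both; its entry at a is nonzero
    because centre entries are.\<close>
  define p where "p = (\<lambda>_. 0)(a := u b, b := - u a)"
  define q where "q = (\<lambda>_. 0)(a := v c * u a, b := v c * u b, c := - (v a * u a + v b * u b))"
  have sum3: "(\<Sum>k<n. f k) = f a + f b + f c" if "\<And>k. k \<notin> {a, b, c} \<Longrightarrow> f k = 0"
    for f :: "nat \<Rightarrow> real"
  proof -
    have "(\<Sum>k<n. f k) = sum f {a, b, c}"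
      using that leaves by (intro sum.mono_neutral_right) auto
    then show ?thesis using dist by simp
  qed
  have p0: "p k = 0" and q0: "q k = 0" if "k \<notin> {a, b, c}" for k
    using that by (auto simp: p_def q_def)
  have pv: "p a = u b" "p b = - u a" "p c = 0"
    and qv: "q a = v c * u a" "q b = v c * u b" "q c = - (v a * u a + v b * u b)"
    using dist by (auto simp: p_def q_def)
  show ?thesis
  proof (rule not_has_nSMP_rank_one[OF A, of p q a a])
    fix i assume i: "i < n"
    have "(\<Sum>k<n. A $$ (i, k) * p k) = A $$ (i, a) * p a + A $$ (i, b) * p b + A $$ (i, c) * p c"
      by (rule sum3) (simp add: p0)
    also have "\<dots> = 0"
      using zcol(1)[of i] i by (cases "i = 0") (auto simp: pv u_def)
    finally show "(\<Sum>k<n. A $$ (i, k) * p k) = 0" .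
  next
    fix j assume j: "j < n"
    have "(\<Sum>k<n. q k * A $$ (k, j)) = q a * A $$ (a, j) + q b * A $$ (b, j) + q c * A $$ (c, j)"
      by (rule sum3) (simp add: q0)
    also have "\<dots> = 0"
      using zcol(2)[of j] j by (cases "j = 0") (auto simp: qv v_def algebra_simps)
    finally show "(\<Sum>k<n. q k * A $$ (k, j)) = 0" .
  next
    have "(\<Sum>k<n. p k * q k) = p a * q a + p b * q b + p c * q c"
      by (rule sum3) (simp add: p0)
    then show "(\<Sum>k<n. p k * q k) = 0" by (simp add: pv qv)
  next
    fix i j assume "i < n" "j < n"
    show "A $$ (i, j) * (q i * p j) = 0"
    proof (cases "i \<in> {a, b, c} \<and> j \<in> {a, b, c}")
      case True
      then have "A $$ (i, j) = 0" using zcol(1)[of i j] leaves by auto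
      then show ?thesis by simp
    next
      case False
      then show ?thesis using p0 q0 by fastforce
    qed
  qed (use leaves unz in \<open>auto simp: pv qv\<close>)
qed

section \<open>Star matrices with the nSMP\<close>

lemma star_mat_nSMP:
  assumes star: "star_mat n A" and n: "0 < n"
    and dist: "\<And>i j. 1 \<le> i \<Longrightarrow> i < n \<Longrightarrow> 1 \<le> j \<Longrightarrow> j < n \<Longrightarrow> A $$ (i, i) = A $$ (j, j) \<Longrightarrow>
      A $$ (i, i) \<noteq> 0 \<Longrightarrow> i = j"
    and zeros: "card {i. 1 \<le> i \<and> i < n \<and> A $$ (i, i) = 0} \<le> 2"
    and uv: "\<And>i j. 1 \<le> i \<Longrightarrow> i < n \<Longrightarrow> 1 \<le> j \<Longrightarrow> j < n \<Longrightarrow> i \<noteq> j \<Longrightarrow>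
      A $$ (0, i) * A $$ (i, 0) + A $$ (0, j) * A $$ (j, 0) \<noteq> 0"
  shows "has_nSMP n A"
  unfolding has_nSMP_def
proof (intro ballI impI)
  fix X :: "real mat"
  assume X: "X \<in> carrier_mat n n" and had: "hadamard_prod A X = 0\<^sub>m n n"
    and comm: "A * X\<^sup>T - X\<^sup>T * A = 0\<^sub>m n n"
    and tr: "\<forall>k<n. mat_trace (X\<^sup>T * (A ^\<^sub>m k)) = 0"
  have A: "A \<in> carrier_mat n n" using star by (simp add: star_mat_def)
  have off: "A $$ (i, j) = 0" if "1 \<le> i" "i < n" "1 \<le> j" "j < n" "i \<noteq> j" for i j
    using star that unfolding star_mat_def by blast
  have centre: "A $$ (0, j) \<noteq> 0" "A $$ (j, 0) \<noteq> 0" if "1 \<le> j" "j < n" for j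
    using star that unfolding star_mat_def by blast+
  have had': "A $$ (i, j) * X $$ (i, j) = 0" if "i < n" "j < n" for i j
    using arg_cong[OF had, of "\<lambda>M. M $$ (i, j)"] that A by (simp add: hadamard_prod_def)
  have X0: "X $$ (0, j) = 0" "X $$ (j, 0) = 0" if "1 \<le> j" "j < n" for j
    using had'[of 0 j] had'[of j 0] centre[OF that] that n by auto
  have comm': "(\<Sum>k<n. A $$ (i, k) * X $$ (j, k)) = (\<Sum>k<n. X $$ (k, i) * A $$ (k, j))"
    if "i < n" "j < n" for i j
    using arg_cong[OF comm, of "\<lambda>M. M $$ (i, j)"] that A X
    by (simp add: scalar_prod_def atLeast0LessThan)
  have single: "(\<Sum>k<n. f k) = f 0 + f i" if "1 \<le> i" "i < n" "\<And>k. 1 \<le> k \<Longrightarrow> k < n \<Longrightarrow> k \<noteq> i \<Longrightarrow> f k = 0"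
    for f :: "nat \<Rightarrow> real" and i
  proof -
    have "(\<Sum>k<n. f k) = sum f {0, i}"
      using that n by (intro sum.mono_neutral_right) auto
    then show ?thesis using that by simp
  qed
  \<comment> \<open>Since X vanishes between centre and leaves, entry (i, j) of the commutation
    relation collapses to one term on each side: a leaf entry of X multiplied by
    \<open>A $$ (i, i)\<close> or by \<open>A $$ (j, j)\<close>.\<close>
  have Xd: "X $$ (j, i) = 0"
    if ij: "1 \<le> i" "i < n" "1 \<le> j" "j < n" "A $$ (i, i) \<noteq> A $$ (j, j)" for i j
  proof -
    have "(\<Sum>k<n. A $$ (i, k) * X $$ (j, k)) = A $$ (i, i) * X $$ (j, i)"
      using single[of i "\<lambda>k. A $$ (i, k) * X $$ (j, k)"] off[of i] X0 ij by simp
    moreover have "(\<Sum>k<n. X $$ (k, i) * A $$ (k, j)) = X $$ (j, i) * A $$ (j, j)"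
      using single[of j "\<lambda>k. X $$ (k, i) * A $$ (k, j)"] off[of _ j] X0 ij by simp
    ultimately show ?thesis using comm'[of i j] ij by simp
  qed
  define y where "y = X $$ (0, 0)"
  \<comment> \<open>The centre row and column of the commutation relation say that u is a right and
    v a left eigenvector of the leaf block of X, both with eigenvalue y.\<close>
  have row: "(\<Sum>k<n. A $$ (0, k) * X $$ (j, k)) = y * A $$ (0, j)" if "1 \<le> j" "j < n" for j
    using comm'[of 0 j] single[of j "\<lambda>k. X $$ (k, 0) * A $$ (k, j)"] X0 that n
    by (simp add: y_def)
  have col: "(\<Sum>k<n. X $$ (k, j) * A $$ (k, 0)) = y * A $$ (j, 0)" if "1 \<le> j" "j < n" for j
    using comm'[of j 0] single[of j "\<lambda>k. A $$ (j, k) * X $$ (0, k)"] X0 that n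
    by (simp add: y_def mult.commute)
  define Z where "Z = {i. 1 \<le> i \<and> i < n \<and> A $$ (i, i) = 0}"
  have finZ: "finite Z" by (simp add: Z_def)
  have trX: "(\<Sum>i<n. X $$ (i, i)) = 0"
    using tr[rule_format, OF n] A X by (simp add: mat_trace_def)
  \<comment> \<open>Leaves outside Z have pairwise distinct nonzero diagonal entries, so two
    different leaves can share a diagonal entry only inside Z.\<close>
  have Xoff: "X $$ (i, j) = 0" if "i < n" "j < n" "i \<noteq> j" "\<not> (i \<in> Z \<and> j \<in> Z)" for i j
  proof (cases "i = 0 \<or> j = 0")
    case True
    then show ?thesis using X0[of i] X0[of j] that by auto
  next
    case False
    then have "A $$ (j, j) \<noteq> A $$ (i, i)" using dist[of i j] that by (auto simp: Z_def)
    then show ?thesis using Xd[of j i] False that by simp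
  qed
  have Xnz: "X $$ (i, i) = 0" if "1 \<le> i" "i < n" "i \<notin> Z" for i
    using had'[of i i] that by (auto simp: Z_def)
  \<comment> \<open>Here j forms a block of size one, so the eigenvector equation for u at j has a
    single term, and u is nonzero at j.\<close>
  have iso: "X $$ (j, j) = y" if j: "1 \<le> j" "j < n" and Zj: "Z \<subseteq> {j} \<or> j \<notin> Z" for j
  proof -
    have "X $$ (j, k) = 0" if "1 \<le> k" "k < n" "k \<noteq> j" for k
      using Xoff[of j k] that j Zj by auto
    then have "A $$ (0, j) * X $$ (j, j) = y * A $$ (0, j)"
      using row[OF j] single[of j "\<lambda>k. A $$ (0, k) * X $$ (j, k)"] X0 j by simp
    then show ?thesis using centre[OF j] by simp
  qed
  have "y = 0 \<and> (\<forall>i<n. \<forall>j<n. X $$ (i, j) = 0)"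
  proof (cases "card Z \<le> 1")
    case True
    then have sub: "j \<in> Z \<Longrightarrow> Z \<subseteq> {j}" for j
      using finZ by (metis card_le_Suc0_iff_eq One_nat_def insertI1 subsetI singletonI)
    \<comment> \<open>All blocks have size one, so X is y times the identity and its trace is n
      y.\<close>
    have diag: "X $$ (j, j) = y" if "j < n" for j
      using iso[of j] sub[of j] that by (cases "j = 0") (auto simp: y_def)
    then have "y = 0" using trX n by simp
    moreover have "X $$ (i, j) = 0" if "i < n" "j < n" "i \<noteq> j" for i j
      using Xoff[OF that] sub[of i] sub[of j] that by auto
    ultimately show ?thesis using diag by metis
  next
    case False
    then have "card Z = 2" using zeros by (simp add: Z_def)
    then obtain p q where Z: "Z = {p, q}" and pq: "p < q"
      by (metis card_2_iff insert_commute linorder_neqE_nat)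
    have p: "1 \<le> p" "p < n" "A $$ (p, p) = 0" and q: "1 \<le> q" "q < n" "A $$ (q, q) = 0"
      using Z by (auto simp: Z_def)
    have two: "(\<Sum>k<n. f k) = f p + f q" if "\<And>k. k < n \<Longrightarrow> k \<noteq> p \<Longrightarrow> k \<noteq> q \<Longrightarrow> f k = 0"
      for f :: "nat \<Rightarrow> real"
    proof -
      have "(\<Sum>k<n. f k) = sum f {p, q}"
        using that p q by (intro sum.mono_neutral_right) auto
      then show ?thesis using pq by simp
    qed
    have rZ: "A $$ (0, p) * X $$ (j, p) + A $$ (0, q) * X $$ (j, q) = y * A $$ (0, j)"
      if "j \<in> Z" for j
    proof -
      have j: "1 \<le> j" "j < n" using that by (auto simp: Z_def)
      have "X $$ (j, k) = 0" if "k < n" "k \<noteq> p" "k \<noteq> q" for k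
        using Xoff[of j k] that j \<open>j \<in> Z\<close> Z by auto
      then show ?thesis using row[OF j] two[of "\<lambda>k. A $$ (0, k) * X $$ (j, k)"] by simp
    qed
    have cZ: "X $$ (p, j) * A $$ (p, 0) + X $$ (q, j) * A $$ (q, 0) = y * A $$ (j, 0)"
      if "j \<in> Z" for j
    proof -
      have j: "1 \<le> j" "j < n" using that by (auto simp: Z_def)
      have "X $$ (k, j) = 0" if "k < n" "k \<noteq> p" "k \<noteq> q" for k
        using Xoff[of k j] that j \<open>j \<in> Z\<close> Z by auto
      then show ?thesis using col[OF j] two[of "\<lambda>k. X $$ (k, j) * A $$ (k, 0)"] by simp
    qed
    have y0: "y = 0"
    \<comment> \<open>A nonzero centre loop gives y = 0 by the entrywise condition, and for n > 3 a
      leaf outside Z does so through \<open>iso\<close> and \<open>Xnz\<close>. What remains is n =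
      3 with zero diagonal. There the trace condition for k = 2 reads 2 y s = 0 with s the scalar
      product of u and v: the centre contributes y s, and the leaves contribute y s by the
      eigenvector equations.\<close>
    proof (cases "A $$ (0, 0) = 0 \<and> n = 3")
      case True
      then have a: "A $$ (0, 0) = 0" and n3: "n = 3" by auto
      have pq12: "p = 1" "q = 2" using p q pq n3 by auto
      define M where "M = A * A"
      have "mat_trace (X\<^sup>T * M) = 0"
        using tr[rule_format, of 2] n3 A by (simp add: M_def numeral_2_eq_2)
      then have tr2: "(\<Sum>i<3. \<Sum>k<3. X $$ (k, i) * (\<Sum>l<3. A $$ (k, l) * A $$ (l, i))) = 0"
        using A X n3 by (simp add: mat_trace_def M_def scalar_prod_def atLeast0LessThan)
      define s where "s = A $$ (0, 1) * A $$ (1, 0) + A $$ (0, 2) * A $$ (2, 0)"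
      have s: "s \<noteq> 0" using uv[of 1 2] n3 by (simp add: s_def)
      have vals: "A $$ (1, 1) = 0" "A $$ (2, 2) = 0" "A $$ (1, 2) = 0" "A $$ (2, 1) = 0"
        "X $$ (0, 1) = 0" "X $$ (0, 2) = 0" "X $$ (1, 0) = 0" "X $$ (2, 0) = 0"
        using p q pq12 off[of 1 2] off[of 2 1] X0[of 1] X0[of 2] n3 by auto
      have s3: "(\<Sum>k<3. f k) = f 0 + f 1 + f 2" for f :: "nat \<Rightarrow> real"
        by (simp add: eval_nat_numeral)
      have "y * s + (A $$ (1, 0) * (A $$ (0, 1) * X $$ (1, 1) + A $$ (0, 2) * X $$ (1, 2)) +
          A $$ (2, 0) * (A $$ (0, 1) * X $$ (2, 1) + A $$ (0, 2) * X $$ (2, 2))) = 0"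
        using tr2 unfolding s3 a vals y_def[symmetric] s_def by (simp add: algebra_simps)
      moreover have "A $$ (0, 1) * X $$ (1, 1) + A $$ (0, 2) * X $$ (1, 2) = y * A $$ (0, 1)"
        "A $$ (0, 1) * X $$ (2, 1) + A $$ (0, 2) * X $$ (2, 2) = y * A $$ (0, 2)"
        using rZ[of 1] rZ[of 2] Z pq12 by auto
      ultimately have "y * s + y * s = 0"
        by (simp only: s_def) (simp add: algebra_simps)
      then show ?thesis using s by simp
    next
      case False
      show ?thesis
      proof (cases "A $$ (0, 0) = 0")
        case True
        then have "n > 3" using False p q pq by linarith
        then have "card {1..<n} > card Z" using \<open>card Z = 2\<close> by simp
        then obtain j where "j \<in> {1..<n}" "j \<notin> Z"
          by (metis card_mono finZ leD subsetI)
        then show ?thesis using iso[of j] Xnz[of j] by simp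
      next
        case False
        then show ?thesis using had'[of 0 0] n by (simp add: y_def)
      qed
    qed
    have out: "X $$ (i, j) = 0" if "i < n" "j < n" "\<not> (i \<in> Z \<and> j \<in> Z)" for i j
    proof (cases "i = j")
      case True
      then show ?thesis using Xnz[of i] y0 that by (cases "i = 0") (auto simp: y_def)
    qed (use Xoff that in blast)
    have "X $$ (p, p) + X $$ (q, q) = 0"
      using trX two[of "\<lambda>k. X $$ (k, k)"] out Z by simp
    then have Xqq: "X $$ (q, q) = - X $$ (p, p)" by simp
    let ?up = "A $$ (0, p)" and ?uq = "A $$ (0, q)" and ?vp = "A $$ (p, 0)" and ?vq = "A $$ (q, 0)"
    note nz = centre[OF p(1,2)] centre[OF q(1,2)]
    have e1: "?up * X $$ (p, p) + ?uq * X $$ (p, q) = 0"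
      and e2: "?up * X $$ (q, p) + ?uq * X $$ (q, q) = 0"
      and e3: "X $$ (p, p) * ?vp + X $$ (q, p) * ?vq = 0"
      using rZ[of p] rZ[of q] cZ[of p] Z y0 by auto
    \<comment> \<open>The block on p, q has trace 0, right kernel vector u and left kernel vector v.
      Eliminating its (q, p) entry between \<open>e2\<close> and \<open>e3\<close> leaves its (p, p)
      entry times the partial scalar product of u and v.\<close>
    have "X $$ (p, p) * (?up * ?vp + ?uq * ?vq) =
        ?up * (X $$ (p, p) * ?vp + X $$ (q, p) * ?vq) - ?vq * (?up * X $$ (q, p) + ?uq * X $$ (q, q))"
      by (simp add: Xqq algebra_simps)
    then have pp: "X $$ (p, p) = 0" unfolding e2 e3 using uv[of p q] p q pq by simp
    then have "X $$ (p, q) = 0" "X $$ (q, p) = 0" "X $$ (q, q) = 0"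
      using e1 e3 Xqq nz by auto
    then have "X $$ (i, j) = 0" if "i < n" "j < n" for i j
      using out[OF that] pp Z by auto
    then show ?thesis using y0 by blast
  qed
  then show "X = 0\<^sub>m n n" using X by (intro eq_matI) auto
qed

section \<open>From matrices to sign patterns\<close>

fun sign_val :: "sign \<Rightarrow> real" where
  "sign_val Pos = 1"
| "sign_val Neg = -1"
| "sign_val Zero = 0"

lemma sign_val_eq_0_iff [simp]: "sign_val s = 0 \<longleftrightarrow> s = Zero"
  by (cases s) auto

lemma abs_sign_val: "s \<noteq> Zero \<Longrightarrow> \<bar>sign_val s\<bar> = 1"
  by (cases s) auto

lemma qualitative_class_eq_0_iff:
  assumes "A \<in> qualitative_class n S" "i < n" "j < n"
  shows "A $$ (i, j) = 0 \<longleftrightarrow> S $$ (i, j) = Zero"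
proof -
  have "(S $$ (i, j) = Pos \<longrightarrow> A $$ (i, j) > 0) \<and> (S $$ (i, j) = Neg \<longrightarrow> A $$ (i, j) < 0) \<and>
      (S $$ (i, j) = Zero \<longrightarrow> A $$ (i, j) = 0)"
    using assms unfolding qualitative_class_def by blast
  then show ?thesis by (cases "S $$ (i, j)") auto
qed

lemma star_mat_if_qualitative_class:
  assumes "star_sign_pattern n S" "A \<in> qualitative_class n S"
  shows "star_mat n A"
proof -
  have "A \<in> carrier_mat n n" using assms(2) by (simp add: qualitative_class_def)
  then show ?thesis
    using assms(1) qualitative_class_eq_0_iff[OF assms(2)]
    unfolding star_mat_def star_sign_pattern_def by auto
qed

lemma star_pattern_allows_nSMP:
  assumes S: "star_sign_pattern n S"
    and zeros: "card {i. 1 \<le> i \<and> i < n \<and> S $$ (i, i) = Zero} \<le> 2"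
  shows "allows n S (has_nSMP n)"
proof -
  \<comment> \<open>The weight j + 1 goes on the centre row and on the diagonal. Whatever the signs,
    nonzero leaf diagonal entries then have distinct moduli, and so do the products of the centre
    row and column entries at different leaves, so no two of these products cancel. The shift by one
    keeps the weight at (0, 0) positive.\<close>
  define w :: "nat \<Rightarrow> nat \<Rightarrow> real"
    where "w i j = (if i = 0 \<or> i = j then real (Suc j) else 1)" for i j
  have w: "w i j > 0" for i j by (simp add: w_def)
  define A where "A = mat n n (\<lambda>(i, j). w i j * sign_val (S $$ (i, j)))"
  have Aij: "A $$ (i, j) = w i j * sign_val (S $$ (i, j))" if "i < n" "j < n" for i j
    using that by (simp add: A_def)
  have n: "0 < n" using S by (simp add: star_sign_pattern_def)
  have AQ: "A \<in> qualitative_class n S"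
    using w by (auto simp: qualitative_class_def A_def)
  have star: "star_mat n A" by (rule star_mat_if_qualitative_class[OF S AQ])
  have "has_nSMP n A"
  proof (rule star_mat_nSMP[OF star n])
    fix i j
    assume ij: "1 \<le> i" "i < n" "1 \<le> j" "j < n"
      and eq: "A $$ (i, i) = A $$ (j, j)" and nz: "A $$ (i, i) \<noteq> 0"
    have "\<bar>A $$ (k, k)\<bar> = real (Suc k)" if "k < n" "A $$ (k, k) \<noteq> 0" for k
      using that by (auto simp: Aij abs_mult abs_sign_val w_def)
    then have "real (Suc i) = real (Suc j)" using eq nz ij by metis
    then show "i = j" by simp
  next
    have "{i. 1 \<le> i \<and> i < n \<and> A $$ (i, i) = 0} = {i. 1 \<le> i \<and> i < n \<and> S $$ (i, i) = Zero}"
      using qualitative_class_eq_0_iff[OF AQ] by auto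
    then show "card {i. 1 \<le> i \<and> i < n \<and> A $$ (i, i) = 0} \<le> 2" using zeros by simp
  next
    fix i j assume ij: "1 \<le> i" "i < n" "1 \<le> j" "j < n" "i \<noteq> j"
    have "\<bar>A $$ (0, k) * A $$ (k, 0)\<bar> = real (Suc k)" if "1 \<le> k" "k < n" for k
      using that n S by (simp add: Aij abs_mult abs_sign_val w_def star_sign_pattern_def)
    from this[of i] this[of j]
    show "A $$ (0, i) * A $$ (i, 0) + A $$ (0, j) * A $$ (j, 0) \<noteq> 0" using ij by linarith
  qed
  then show ?thesis using AQ by (auto simp: allows_def)
qed

text \<open>A zero of the pattern is a zero of every matrix in its class, so one choice of three
  loopless leaves rules out all of these matrices.\<close>

lemma star_pattern_not_allows_nSMP:
  assumes S: "star_sign_pattern n S"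
    and zeros: "3 \<le> card {i. 1 \<le> i \<and> i < n \<and> S $$ (i, i) = Zero}"
  shows "\<not> allows n S (has_nSMP n)"
proof -
  obtain T where T: "T \<subseteq> {i. 1 \<le> i \<and> i < n \<and> S $$ (i, i) = Zero}" "card T = 3"
    using obtain_subset_with_card_n[OF zeros] by metis
  then obtain a b c where "T = {a, b, c}" "a \<noteq> b" "a \<noteq> c" "b \<noteq> c"
    by (auto simp: card_3_iff)
  then show ?thesis
    using T(1) star_mat_three_zeros_not_nSMP[OF star_mat_if_qualitative_class[OF S], of _ a b c]
      qualitative_class_eq_0_iff[of _ n S]
    by (auto simp: allows_def)
qed

section \<open>Counting loops\<close>

lemma card_noncentre_loops:
  "card (noncentre_loops (pattern_digraph n S)) +
   card {i. 1 \<le> i \<and> i < n \<and> S $$ (i, i) = Zero} = n - 1"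
proof -
  let ?L = "{i. 1 \<le> i \<and> i < n \<and> S $$ (i, i) \<noteq> Zero}"
  let ?Z = "{i. 1 \<le> i \<and> i < n \<and> S $$ (i, i) = Zero}"
  have "noncentre_loops (pattern_digraph n S) = (\<lambda>i. (i, i)) ` ?L"
    by (auto simp: noncentre_loops_def pattern_digraph_def)
  then have "card (noncentre_loops (pattern_digraph n S)) = card ?L"
    by (simp add: card_image inj_on_def)
  moreover have "?L \<union> ?Z = {1..<n}" by auto
  then have "card ?L + card ?Z = card {1..<n}"
    by (subst card_Un_disjoint[symmetric]) auto
  ultimately show ?thesis by simp
qed

theorem corollary4p3:
  fixes n :: nat and \<A> :: "sign mat"
  assumes "star_sign_pattern n \<A>"
  shows "\<not> allows n \<A> (has_nSMP n) \<longleftrightarrow>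
           int (card (noncentre_loops (pattern_digraph n \<A>))) < int n - 3"
proof -
  have "0 < n" using assms by (simp add: star_sign_pattern_def)
  moreover have "\<not> allows n \<A> (has_nSMP n) \<longleftrightarrow>
      3 \<le> card {i. 1 \<le> i \<and> i < n \<and> \<A> $$ (i, i) = Zero}"
    using star_pattern_allows_nSMP[OF assms] star_pattern_not_allows_nSMP[OF assms] by linarith
  \<comment> \<open>As n is positive, the natural number \<open>n - 1\<close> is not truncated;
    fewer than n - 3 of the n - 1 leaves carry a loop exactly when at least three carry
    none.\<close>
  ultimately show ?thesis using card_noncentre_loops[of n \<A>] by linarith
qed

end
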